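(* Let $C\in\mathbb{S}^n$, let $\mathcal{A}:\mathbb{S}^n\to\mathbb{R}^d$ be linear and $b\in\mathbb{R}^d$. Consider the semidefinite program $$\text{(SDP)}\quad \max_X\ \langle C,X\rangle\quad\text{subject to }\mathcal{A}(X)=b,\ X\succeq0,$$ its dual $$\text{(DSDP)}\quad\min_y\ b^Ty\quad\text{subject to }\mathcal{A}^*(y)-C\succeq0,$$ and, for $M,\beta>0$, the penalized problem $$\text{(SDP-LSE)}\quad\max_X\ \langle C,X\rangle-\beta\,\phi_M(\mathcal{A}(X)-b)\quad\text{subject to }\mathrm{Tr}(X)\le\alpha,\ X\succeq0.$$ Let $(X^\star_{SDP},y^\star_{SDP})$ be an optimal solution of the primal-dual pair (SDP)-(DSDP) and let $\widehat X_\epsilon$ be an $\epsilon$-optimal solution of (SDP-LSE). If $\beta>\|y^\star_{SDP}\|_1$, then $$\langle C,X^\star_{SDP}\rangle-\epsilon\ \le\ \langle C,\widehat X_\epsilon\rangle\ \le\ \langle C,X^\star_{SDP}\rangle+\|y^\star_{SDP}\|_1\,\frac{\beta\frac{\log(2d)}{M}+\epsilon}{\beta-\|y^\star_{SDP}\|_1},$$ and $$\|\mathcal{A}(\widehat X_\epsilon)-b\|_\infty\ \le\ \frac{\beta\frac{\log(2d)}{M}+\epsilon}{\beta-\|y^\star_{SDP}\|_1}.$$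
   Context: $\mathbb{S}^n$: real symmetric $n\times n$ matrices; $\langle A,B\rangle=\mathrm{Tr}(A^TB)$; $\mathcal{A}^*$: adjoint of $\mathcal{A}$. For $M>0$, $\phi_M:\mathbb{R}^d\to\mathbb{R}$ is $\phi_M(v)=\frac1M\log\left(\sum_{i=1}^de^{Mv_i}+\sum_{i=1}^de^{-Mv_i}\right)$. A feasible point is $\epsilon$-optimal for a maximization problem if its objective value is at least the maximum minus $\epsilon$. Standing assumptions: the feasible region of (SDP) is nonempty and bounded, and $\alpha$ is chosen so that $X\succeq0$ and $\mathcal{A}(X)=b$ imply $\mathrm{Tr}(X)\le\alpha$; a constraint qualification holds so that strong duality is satisfied, i.e. (SDP) and (DSDP) have equal finite optimal values, and a primal-dual optimal pair exists. *)

theory Defs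
  imports "HOL-Analysis.Analysis"
begin

definition sym_mats :: "(real^'n^'n) set" where
  "sym_mats = {X. transpose X = X}"

definition psd :: "real^'n^'n \<Rightarrow> bool" where
  "psd X \<longleftrightarrow> X \<in> sym_mats \<and> (\<forall>v. 0 \<le> v \<bullet> (X *v v))"

definition frob :: "real^'n^'n \<Rightarrow> real^'n^'n \<Rightarrow> real" where
  "frob A B = trace (transpose A ** B)"

lemma frob_eq_inner: "frob A B = A \<bullet> B"
  unfolding frob_def trace_def transpose_def matrix_matrix_mult_def inner_vec_def
  by (simp, rule sum.swap)

(* The domain of \<A> is the space of symmetric matrices, which is not a type here:
   \<A> is a function on all matrices, whose values outside sym_mats never matter. *)

definition linear_on_sym :: "(real^'n^'n \<Rightarrow> real^'d) \<Rightarrow> bool" where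
  "linear_on_sym \<A> \<longleftrightarrow>
     (\<forall>X\<in>sym_mats. \<forall>Y\<in>sym_mats. \<A> (X + Y) = \<A> X + \<A> Y) \<and>
     (\<forall>c. \<forall>X\<in>sym_mats. \<A> (c *\<^sub>R X) = c *\<^sub>R \<A> X)"

(* The adjoint relative to the symmetric matrices, hence symmetric-valued. The library's
   adjoint refers to the space of all matrices, so its values need not be symmetric. *)

definition sym_adjoint :: "(real^'n^'n \<Rightarrow> real^'d) \<Rightarrow> real^'d \<Rightarrow> real^'n^'n" where
  "sym_adjoint \<A> y = (THE Y. Y \<in> sym_mats \<and> (\<forall>X\<in>sym_mats. frob Y X = y \<bullet> \<A> X))"

lemma sym_mats_lincomb:
  "X \<in> sym_mats \<Longrightarrow> Y \<in> sym_mats \<Longrightarrow> X + Y \<in> sym_mats"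
  "X \<in> sym_mats \<Longrightarrow> c *\<^sub>R X \<in> sym_mats"
  "X \<in> sym_mats \<Longrightarrow> Y \<in> sym_mats \<Longrightarrow> X - Y \<in> sym_mats"
  by (auto simp: sym_mats_def transpose_def vec_eq_iff)

lemma sym_adjoint_ex1:
  fixes \<A> :: "real^'n^'n \<Rightarrow> real^'d"
  assumes "linear_on_sym \<A>"
  shows "\<exists>!Y. Y \<in> sym_mats \<and> (\<forall>X\<in>sym_mats. frob Y X = y \<bullet> \<A> X)"
proof (rule ex_ex1I)
  let ?s = "\<lambda>X::real^'n^'n. (1/2) *\<^sub>R (X + transpose X)"
  have s_sym: "?s X \<in> sym_mats" for X
    by (auto simp: sym_mats_def transpose_def vec_eq_iff)
  have s_id: "?s X = X" if "X \<in> sym_mats" for X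
    using that by (auto simp: sym_mats_def vec_eq_iff)
  have s_add: "?s (X + Y) = ?s X + ?s Y" for X Y
    by (auto simp: transpose_def vec_eq_iff field_simps)
  have s_scale: "?s (c *\<^sub>R X) = c *\<^sub>R ?s X" for c X
    by (auto simp: transpose_def vec_eq_iff algebra_simps)
  have s_self: "?s Z \<bullet> X = Z \<bullet> ?s X" for Z X
  proof -
    have "transpose Z \<bullet> X = Z \<bullet> transpose X"
      unfolding transpose_def inner_vec_def by (simp, rule sum.swap)
    then show ?thesis by (simp add: inner_add_left inner_add_right)
  qed
  define B where "B = (\<lambda>X. \<A> (?s X))"
  have "linear B"
  proof (rule linearI)
    show "B (X + Y) = B X + B Y" for X Y
      unfolding B_def s_add using assms s_sym by (simp only: linear_on_sym_def)
    show "B (c *\<^sub>R X) = c *\<^sub>R B X" for c X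
      unfolding B_def s_scale using assms s_sym by (simp only: linear_on_sym_def)
  qed
  have "frob (?s (adjoint B y)) X = y \<bullet> \<A> X" if "X \<in> sym_mats" for X
  proof -
    have "frob (?s (adjoint B y)) X = adjoint B y \<bullet> X"
      by (simp only: frob_eq_inner s_self s_id[OF that])
    also have "\<dots> = y \<bullet> B X"
      using adjoint_works[OF \<open>linear B\<close>] by (simp add: inner_commute)
    finally show ?thesis by (simp only: B_def s_id[OF that])
  qed
  then show "\<exists>Y. Y \<in> sym_mats \<and> (\<forall>X\<in>sym_mats. frob Y X = y \<bullet> \<A> X)"
    using s_sym by blast
next
  fix Y Z
  assume Y: "Y \<in> sym_mats \<and> (\<forall>X\<in>sym_mats. frob Y X = y \<bullet> \<A> X)"
    and Z: "Z \<in> sym_mats \<and> (\<forall>X\<in>sym_mats. frob Z X = y \<bullet> \<A> X)"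
  then have "Y \<bullet> (Y - Z) = Z \<bullet> (Y - Z)"
    using sym_mats_lincomb(3)[of Y Z] by (simp add: frob_eq_inner)
  then have "(Y - Z) \<bullet> (Y - Z) = 0" by (simp add: inner_diff_left)
  then show "Y = Z" by simp
qed

definition l1norm :: "real^'d \<Rightarrow> real" where
  "l1norm v = (\<Sum>i\<in>UNIV. \<bar>v $ i\<bar>)"

definition phi_lse :: "real \<Rightarrow> real^'d \<Rightarrow> real" where
  "phi_lse M v = (1 / M) * ln ((\<Sum>i\<in>UNIV. exp (M * v $ i)) + (\<Sum>i\<in>UNIV. exp (- M * v $ i)))"

definition sdp_feasible :: "(real^'n^'n \<Rightarrow> real^'d) \<Rightarrow> real^'d \<Rightarrow> (real^'n^'n) set" where
  "sdp_feasible \<A> b = {X. \<A> X = b \<and> psd X}"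

definition sdp_optimal ::
  "real^'n^'n \<Rightarrow> (real^'n^'n \<Rightarrow> real^'d) \<Rightarrow> real^'d \<Rightarrow> real^'n^'n \<Rightarrow> bool" where
  "sdp_optimal C \<A> b = is_arg_max (frob C) (\<lambda>X. X \<in> sdp_feasible \<A> b)"

definition dsdp_feasible :: "real^'n^'n \<Rightarrow> (real^'n^'n \<Rightarrow> real^'d) \<Rightarrow> (real^'d) set" where
  "dsdp_feasible C \<A> = {y. psd (sym_adjoint \<A> y - C)}"

definition dsdp_optimal ::
  "real^'n^'n \<Rightarrow> (real^'n^'n \<Rightarrow> real^'d) \<Rightarrow> real^'d \<Rightarrow> real^'d \<Rightarrow> bool" where
  "dsdp_optimal C \<A> b = is_arg_min (\<lambda>y. b \<bullet> y) (\<lambda>y. y \<in> dsdp_feasible C \<A>)"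

(* Both optimal values are attained (hence finite) and they are equal. *)

definition strong_duality ::
  "real^'n^'n \<Rightarrow> (real^'n^'n \<Rightarrow> real^'d) \<Rightarrow> real^'d \<Rightarrow> bool" where
  "strong_duality C \<A> b \<longleftrightarrow>
     (\<exists>X y. sdp_optimal C \<A> b X \<and> dsdp_optimal C \<A> b y \<and> frob C X = b \<bullet> y)"

definition lse_feasible :: "real \<Rightarrow> (real^'n^'n) set" where
  "lse_feasible \<alpha> = {X. trace X \<le> \<alpha> \<and> psd X}"

definition lse_objective ::
  "real^'n^'n \<Rightarrow> (real^'n^'n \<Rightarrow> real^'d) \<Rightarrow> real^'d \<Rightarrow> real \<Rightarrow> real \<Rightarrow> real^'n^'n \<Rightarrow> real" where
  "lse_objective C \<A> b M \<beta> X = frob C X - \<beta> * phi_lse M (\<A> X - b)"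

(* Sup on the reals is meaningful only for sets that are nonempty and bounded above; for the
   penalized problem it is the maximum, the objective being continuous on a compact set. *)

definition eps_optimal :: "('a \<Rightarrow> real) \<Rightarrow> 'a set \<Rightarrow> real \<Rightarrow> 'a \<Rightarrow> bool" where
  "eps_optimal f S \<epsilon> x \<longleftrightarrow> x \<in> S \<and> (SUP z\<in>S. f z) - \<epsilon> \<le> f x"

end

theory Submission
  imports Defs
begin

text \<open>
  Write \<open>r = \<A> X - b\<close> for the residual of a psd matrix \<open>X\<close>, and \<open>R\<close> for its sup norm.
  The dual optimum bounds how much can be gained by violating the constraints: since
  \<open>\<A>\<^sup>*(y) - C\<close> is psd and the psd cone is self-dual (\<open>frob_psd_nonneg\<close>),
  \<open>\<langle>C, X\<rangle> \<le> y \<bullet> \<A> X = b \<bullet> y + y \<bullet> r\<close>, and by strong duality and Hoelder's inequality this is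
  at most \<open>\<langle>C, X\<^sub>S\<rangle> + \<parallel>y\<parallel>\<^sub>1 R\<close> (\<open>frob_le_dual_plus_violation\<close>).

  The penalty \<open>\<phi>\<^sub>M\<close> is a smoothing of the sup norm from above, \<open>R \<le> \<phi>\<^sub>M(r)\<close>, and attains its
  minimum \<open>log(2d)/M\<close> at \<open>r = 0\<close>. When \<open>\<beta> > \<parallel>y\<parallel>\<^sub>1\<close> the penalized objective is therefore at
  most \<open>\<langle>C, X\<^sub>S\<rangle> - (\<beta> - \<parallel>y\<parallel>\<^sub>1) R\<close>, whereas near-optimality, compared with the
  competitor \<open>X\<^sub>S\<close>, forces it to be at least \<open>\<langle>C, X\<^sub>S\<rangle> - \<beta> log(2d)/M - \<epsilon>\<close>. The two together give the
  bound on \<open>R\<close>, and substituting it into the duality bound gives the upper estimate of the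
  objective. The lower estimate is the comparison with \<open>X\<^sub>S\<close> again, now using
  \<open>\<phi>\<^sub>M(r) \<ge> \<phi>\<^sub>M(0)\<close>.
\<close>

section \<open>Self-duality of the positive semidefinite cone\<close>

lemma inner_matrix_sym:
  fixes A :: "real^'n^'n"
  assumes "A \<in> sym_mats"
  shows "w \<bullet> (A *v v) = v \<bullet> (A *v w)"
  using assms dot_lmul_matrix[of w A v]
  by (simp add: sym_mats_def inner_commute transpose_matrix_vector[symmetric])

lemma quadratic_form_line:
  fixes A :: "real^'n^'n"
  assumes "A \<in> sym_mats"
  shows "(v + t *\<^sub>R w) \<bullet> (A *v (v + t *\<^sub>R w))
    = v \<bullet> (A *v v) + 2 * t * (v \<bullet> (A *v w)) + t\<^sup>2 * (w \<bullet> (A *v w))"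
  using inner_matrix_sym[OF assms, of w v]
  by (simp add: matrix_vector_right_distrib matrix_vector_mult_scaleR inner_add_left
      inner_add_right algebra_simps power2_eq_square)

lemma axis_inner_matrix_axis:
  fixes A :: "real^'n^'n"
  shows "axis i 1 \<bullet> (A *v axis j 1) = A $ i $ j"
  by (simp add: matrix_vector_mult_basis column_def inner_axis')

lemma psd_diag_nonneg:
  assumes "psd A"
  shows "0 \<le> A $ i $ i"
  using assms axis_inner_matrix_axis[of i A i] by (metis psd_def)

lemma psd_zero_diag:
  fixes A :: "real^'n^'n"
  assumes "psd A" and "\<And>i. A $ i $ i = 0"
  shows "A = 0"
proof -
  have "A $ i $ j = 0" for i j
  proof -
    \<comment> \<open>Without diagonal terms the form is linear along \<open>e\<^sub>i + t e\<^sub>j\<close>; the step \<open>t = - A\<^sub>i\<^sub>j\<close>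
      makes it \<open>- 2 A\<^sub>i\<^sub>j\<^sup>2\<close>.\<close>
    let ?u = "axis i 1 + (- (A $ i $ j)) *\<^sub>R axis j 1 :: real^'n"
    have "0 \<le> ?u \<bullet> (A *v ?u)" using assms(1) by (simp only: psd_def)
    also have "\<dots> = - 2 * (A $ i $ j)\<^sup>2"
      using assms by (subst quadratic_form_line)
        (auto simp: psd_def axis_inner_matrix_axis power2_eq_square)
    finally show ?thesis by simp
  qed
  then show ?thesis by (simp add: vec_eq_iff)
qed

definition outer_product :: "real^'n \<Rightarrow> real^'n^'n" where
  "outer_product a = (\<chi> i j. a $ i * a $ j)"

lemma outer_product_sym: "outer_product a \<in> sym_mats"
  by (simp add: outer_product_def sym_mats_def transpose_def vec_eq_iff mult.commute)

lemma inner_outer_product: "v \<bullet> (outer_product a *v v) = (v \<bullet> a)\<^sup>2"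
  by (simp add: outer_product_def inner_vec_def matrix_vector_mult_def power2_eq_square
      sum_product sum_distrib_left mult_ac)

lemma frob_outer_product: "frob (outer_product a) B = a \<bullet> (B *v a)"
  by (simp add: frob_eq_inner outer_product_def inner_vec_def matrix_vector_mult_def
      sum_distrib_left mult_ac)

text \<open>
  One step of symmetric Gaussian elimination (Cholesky): the form of the Schur complement at \<open>v\<close>
  is the minimum of the form of \<open>A\<close> on the line through \<open>v\<close> in direction \<open>e\<^sub>i\<close>, hence
  nonnegative.
\<close>

lemma psd_schur_complement:
  fixes A :: "real^'n^'n"
  assumes "psd A" and "0 < A $ i $ i"
  shows "psd (A - (1 / A $ i $ i) *\<^sub>R outer_product (A *v axis i 1))"
  unfolding psd_def
proof (intro conjI allI)
  let ?a = "A *v axis i 1"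
  show "A - (1 / A $ i $ i) *\<^sub>R outer_product ?a \<in> sym_mats"
    using assms(1) by (intro sym_mats_lincomb outer_product_sym) (simp add: psd_def)
  fix v :: "real^'n"
  let ?t = "- (v \<bullet> ?a) / A $ i $ i"
  have "0 \<le> (v + ?t *\<^sub>R axis i 1) \<bullet> (A *v (v + ?t *\<^sub>R axis i 1))"
    using assms(1) by (simp only: psd_def)
  also have "\<dots> = v \<bullet> (A *v v) - (v \<bullet> ?a)\<^sup>2 / A $ i $ i"
    using assms by (subst quadratic_form_line)
      (auto simp: psd_def axis_inner_matrix_axis power2_eq_square field_simps)
  also have "\<dots> = v \<bullet> ((A - (1 / A $ i $ i) *\<^sub>R outer_product ?a) *v v)"
    by (simp add: matrix_vector_mult_diff_rdistrib inner_diff_right scaleR_matrix_vector_assoc[symmetric]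
        inner_outer_product)
  finally show "0 \<le> v \<bullet> ((A - (1 / A $ i $ i) *\<^sub>R outer_product ?a) *v v)" .
qed

text \<open>
  Elimination writes \<open>A\<close> as a nonnegative combination of matrices \<open>a a\<^sup>T\<close>, and
  \<open>\<langle>a a\<^sup>T, B\<rangle> = a \<bullet> B a \<ge> 0\<close>. This avoids the spectral theorem. The induction counts the
  nonzero diagonal entries: each step clears its pivot, and it cannot create a new one because
  diagonal entries only decrease and stay nonnegative.
\<close>

lemma frob_psd_nonneg:
  fixes A B :: "real^'n^'n"
  assumes "psd A" and "psd B"
  shows "0 \<le> frob A B"
  using assms(1)
proof (induction "card {i. A $ i $ i \<noteq> 0}" arbitrary: A rule: less_induct)
  case less
  show ?case
  proof (cases "\<exists>i. A $ i $ i \<noteq> 0")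
    case False
    then have "A = 0" using psd_zero_diag[OF less.prems] by blast
    then show ?thesis by (simp add: frob_eq_inner)
  next
    case True
    then obtain i where "A $ i $ i \<noteq> 0" by blast
    then have pos: "0 < A $ i $ i" using psd_diag_nonneg[OF less.prems, of i] by linarith
    let ?a = "A *v axis i 1"
    define A' where "A' = A - (1 / A $ i $ i) *\<^sub>R outer_product ?a"
    have psd': "psd A'" unfolding A'_def by (rule psd_schur_complement[OF less.prems pos])
    have diag: "A' $ j $ j = A $ j $ j - (A $ j $ i)\<^sup>2 / A $ i $ i" for j
      by (simp add: A'_def outer_product_def matrix_vector_mult_basis column_def power2_eq_square)
    have "A' $ j $ j = 0" if "A $ j $ j = 0" for j
      using diag[of j] that psd_diag_nonneg[OF psd', of j] pos
        divide_nonneg_pos[OF zero_le_power2[of "A $ j $ i"] pos] by linarith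
    moreover have "A' $ i $ i = 0" using diag[of i] pos by (simp add: power2_eq_square)
    ultimately have "{j. A' $ j $ j \<noteq> 0} \<subset> {j. A $ j $ j \<noteq> 0}" using pos by force
    then have "0 \<le> frob A' B" using less.hyps psd' by (simp add: psubset_card_mono)
    moreover have "frob A B = frob A' B + (1 / A $ i $ i) * (?a \<bullet> (B *v ?a))"
      unfolding frob_outer_product[symmetric]
      by (simp add: A'_def frob_eq_inner inner_diff_left)
    moreover have "0 \<le> ?a \<bullet> (B *v ?a)" using assms(2) by (simp only: psd_def)
    ultimately show ?thesis using pos by simp
  qed
qed

section \<open>The log-sum-exp penalty\<close>

lemma phi_lse_zero: "phi_lse M (0 :: real^'d) = ln (2 * real CARD('d)) / M"
  by (simp add: phi_lse_def)

text \<open>Paired by coordinate, the summands are \<open>2 cosh (M v\<^sub>i)\<close>, smallest at \<open>v\<^sub>i = 0\<close>.\<close>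

lemma phi_lse_minimum_zero:
  fixes v :: "real^'d"
  assumes "M > 0"
  shows "phi_lse M (0 :: real^'d) \<le> phi_lse M v"
proof -
  have "2 \<le> exp x + exp (- x)" for x :: real
    using cosh_real_ge_1[of x] by (simp add: cosh_def)
  then have "(\<Sum>i\<in>(UNIV :: 'd set). 2) \<le> (\<Sum>i\<in>UNIV. exp (M * v $ i) + exp (- (M * v $ i)))"
    by (intro sum_mono)
  then show ?thesis
    using assms by (simp add: phi_lse_def sum.distrib divide_right_mono ln_mono mult.commute)
qed

text \<open>
  All summands are positive and one of the two belonging to \<open>k\<close> is \<open>exp (M \<bar>v\<^sub>k\<bar>)\<close>, so the
  logarithm of the sum is at least \<open>M \<bar>v\<^sub>k\<bar>\<close>.
\<close>

lemma infnorm_le_phi_lse: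
  fixes v :: "real^'d"
  assumes "M > 0"
  shows "infnorm v \<le> phi_lse M v"
proof -
  let ?S = "(\<Sum>i\<in>UNIV. exp (M * v $ i)) + (\<Sum>i\<in>UNIV. exp (- M * v $ i))"
  have "\<bar>v $ k\<bar> \<le> phi_lse M v" for k
  proof -
    have "exp (M * v $ k) \<le> (\<Sum>i\<in>UNIV. exp (M * v $ i))"
      and "exp (- M * v $ k) \<le> (\<Sum>i\<in>UNIV. exp (- M * v $ i))"
      by (rule member_le_sum; simp)+
    moreover have "0 \<le> (\<Sum>i\<in>UNIV. exp (M * v $ i))" "0 \<le> (\<Sum>i\<in>UNIV. exp (- M * v $ i))"
      by (simp_all add: sum_nonneg)
    ultimately have le: "exp (M * \<bar>v $ k\<bar>) \<le> ?S"
      by (cases "0 \<le> v $ k") simp_all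
    then have "M * \<bar>v $ k\<bar> \<le> ln ?S"
      using exp_gt_zero[of "M * \<bar>v $ k\<bar>"] by (subst ln_ge_iff) linarith+
    then show ?thesis
      using assms by (simp add: phi_lse_def field_simps)
  qed
  then show ?thesis
    by (auto simp: infnorm_cart intro!: cSup_least)
qed

section \<open>Duality bounds\<close>

lemma inner_le_l1norm_infnorm:
  fixes y r :: "real^'d"
  shows "y \<bullet> r \<le> l1norm y * infnorm r"
proof -
  have "y $ i * r $ i \<le> \<bar>y $ i\<bar> * infnorm r" for i
  proof -
    have "y $ i * r $ i \<le> \<bar>y $ i\<bar> * \<bar>r $ i\<bar>" by (metis abs_ge_self abs_mult)
    also have "\<dots> \<le> \<bar>y $ i\<bar> * infnorm r"
      by (intro mult_left_mono component_le_infnorm_cart) simp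
    finally show ?thesis .
  qed
  then show ?thesis
    by (simp add: inner_vec_def l1norm_def sum_distrib_right sum_mono)
qed

text \<open>
  Weak duality for a psd matrix that need not satisfy \<open>\<A> X = b\<close>: the residual enters through
  the multiplier \<open>y\<close>.
\<close>

lemma frob_le_dual_plus_violation:
  fixes C X :: "real^'n^'n" and \<A> :: "real^'n^'n \<Rightarrow> real^'d"
  assumes "linear_on_sym \<A>" and "y \<in> dsdp_feasible C \<A>" and "psd X"
  shows "frob C X \<le> b \<bullet> y + l1norm y * infnorm (\<A> X - b)"
proof -
  have "frob (sym_adjoint \<A> y) X = y \<bullet> \<A> X"
    using theI'[OF sym_adjoint_ex1[OF assms(1), of y]] assms(3)
    by (simp add: sym_adjoint_def psd_def)
  moreover have "0 \<le> frob (sym_adjoint \<A> y - C) X"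
    using assms(2,3) by (simp add: dsdp_feasible_def frob_psd_nonneg)
  ultimately have "frob C X \<le> y \<bullet> \<A> X"
    by (simp add: frob_eq_inner inner_diff_left)
  also have "\<dots> = b \<bullet> y + y \<bullet> (\<A> X - b)"
    by (simp add: inner_diff_right inner_commute)
  also have "\<dots> \<le> b \<bullet> y + l1norm y * infnorm (\<A> X - b)"
    using inner_le_l1norm_infnorm[of y "\<A> X - b"] by simp
  finally show ?thesis .
qed

lemma strong_duality_optimal_values:
  assumes "strong_duality C \<A> b" and "sdp_optimal C \<A> b X" and "dsdp_optimal C \<A> b y"
  shows "frob C X = b \<bullet> y"
proof -
  obtain X' y' where *: "sdp_optimal C \<A> b X'" "dsdp_optimal C \<A> b y'" "frob C X' = b \<bullet> y'"
    using assms(1) by (auto simp: strong_duality_def)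
  have "frob C X = frob C X'"
    using *(1) assms(2) unfolding sdp_optimal_def is_arg_max_def by (meson linorder_less_linear)
  moreover have "b \<bullet> y = b \<bullet> y'"
    using *(2) assms(3) unfolding dsdp_optimal_def is_arg_min_def by (meson linorder_less_linear)
  ultimately show ?thesis using *(3) by simp
qed

text \<open>
  If \<open>\<beta> > \<parallel>y\<parallel>\<^sub>1\<close>, the penalty outweighs any gain from violating the constraints. The
  penalized objective is then bounded above on the whole psd cone, so its supremum over the
  trace-bounded part is meaningful without a compactness argument.
\<close>

lemma lse_objective_upper_bound:
  fixes C X :: "real^'n^'n" and \<A> :: "real^'n^'n \<Rightarrow> real^'d"
  assumes "linear_on_sym \<A>" and "y \<in> dsdp_feasible C \<A>" and "psd X" and "M > 0" and "\<beta> \<ge> 0"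
  shows "lse_objective C \<A> b M \<beta> X \<le> b \<bullet> y - (\<beta> - l1norm y) * infnorm (\<A> X - b)"
proof -
  have "\<beta> * infnorm (\<A> X - b) \<le> \<beta> * phi_lse M (\<A> X - b)"
    using assms by (intro mult_left_mono infnorm_le_phi_lse)
  then show ?thesis
    using frob_le_dual_plus_violation[OF assms(1-3), of b]
    by (simp add: lse_objective_def algebra_simps)
qed

section \<open>The penalized problem approximates the semidefinite program\<close>

theorem lemma3p2:
  fixes C :: "real^'n^'n"
    and \<A> :: "real^'n^'n \<Rightarrow> real^'d"
    and b :: "real^'d"
    and \<alpha> M \<beta> \<epsilon> :: real
    and X\<^sub>S X\<^sub>\<epsilon> :: "real^'n^'n"
    and y\<^sub>S :: "real^'d"
  assumes "C \<in> sym_mats"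
    and "linear_on_sym \<A>"
    and "sdp_feasible \<A> b \<noteq> {}"
    and "bounded (sdp_feasible \<A> b)"
    and "\<forall>X. psd X \<and> \<A> X = b \<longrightarrow> trace X \<le> \<alpha>"
    and "strong_duality C \<A> b"
    and "M > 0"
    and "\<beta> > 0"
    and "sdp_optimal C \<A> b X\<^sub>S"
    and "dsdp_optimal C \<A> b y\<^sub>S"
    and "eps_optimal (lse_objective C \<A> b M \<beta>) (lse_feasible \<alpha>) \<epsilon> X\<^sub>\<epsilon>"
    and "\<beta> > l1norm y\<^sub>S"
  shows "frob C X\<^sub>S - \<epsilon> \<le> frob C X\<^sub>\<epsilon>
    \<and> frob C X\<^sub>\<epsilon> \<le> frob C X\<^sub>S
        + l1norm y\<^sub>S * ((\<beta> * (ln (2 * real CARD('d)) / M) + \<epsilon>) / (\<beta> - l1norm y\<^sub>S))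
    \<and> infnorm (\<A> X\<^sub>\<epsilon> - b)
        \<le> (\<beta> * (ln (2 * real CARD('d)) / M) + \<epsilon>) / (\<beta> - l1norm y\<^sub>S)"
proof -
  note lin = assms(2) and M = assms(7) and \<beta> = assms(8) and gap = assms(12)
  let ?L = "ln (2 * real CARD('d)) / M"
  let ?R = "infnorm (\<A> X\<^sub>\<epsilon> - b)"
  let ?D = "(\<beta> * ?L + \<epsilon>) / (\<beta> - l1norm y\<^sub>S)"
  have y: "y\<^sub>S \<in> dsdp_feasible C \<A>"
    using assms(10) by (simp add: dsdp_optimal_def is_arg_min_def)
  have XS: "\<A> X\<^sub>S = b" "psd X\<^sub>S"
    using assms(9) by (simp_all add: sdp_optimal_def is_arg_max_def sdp_feasible_def)
  have dual: "frob C X\<^sub>S = b \<bullet> y\<^sub>S"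
    using strong_duality_optimal_values assms(6,9,10) by blast
  have psd\<epsilon>: "psd X\<^sub>\<epsilon>" and sup: "(SUP Z\<in>lse_feasible \<alpha>. lse_objective C \<A> b M \<beta> Z) - \<epsilon>
      \<le> lse_objective C \<A> b M \<beta> X\<^sub>\<epsilon>"
    using assms(11) by (simp_all add: eps_optimal_def lse_feasible_def)
  have upper: "lse_objective C \<A> b M \<beta> X
      \<le> frob C X\<^sub>S - (\<beta> - l1norm y\<^sub>S) * infnorm (\<A> X - b)" if "psd X"
    for X :: "real^'n^'n"
    using lse_objective_upper_bound[OF lin y that M] \<beta> dual by simp
  have "bdd_above (lse_objective C \<A> b M \<beta> ` lse_feasible \<alpha>)"
  proof (rule bdd_aboveI2)
    fix X :: "real^'n^'n" assume "X \<in> lse_feasible \<alpha>"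
    then have "psd X" by (simp add: lse_feasible_def)
    moreover have "0 \<le> (\<beta> - l1norm y\<^sub>S) * infnorm (\<A> X - b)"
      using gap by (simp add: infnorm_pos_le)
    ultimately show "lse_objective C \<A> b M \<beta> X \<le> frob C X\<^sub>S" using upper[of X] by linarith
  qed
  moreover have "X\<^sub>S \<in> lse_feasible \<alpha>"
    using XS assms(5) by (simp add: lse_feasible_def)
  ultimately have "lse_objective C \<A> b M \<beta> X\<^sub>S - \<epsilon> \<le> lse_objective C \<A> b M \<beta> X\<^sub>\<epsilon>"
    using sup cSUP_upper[of X\<^sub>S] by fastforce
  then have near: "frob C X\<^sub>S - \<beta> * ?L - \<epsilon> \<le> lse_objective C \<A> b M \<beta> X\<^sub>\<epsilon>"
    by (simp add: lse_objective_def XS phi_lse_zero)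
  have "\<beta> * ?L \<le> \<beta> * phi_lse M (\<A> X\<^sub>\<epsilon> - b)"
    using phi_lse_minimum_zero[OF M, of "\<A> X\<^sub>\<epsilon> - b"] \<beta>
    unfolding phi_lse_zero by (intro mult_left_mono) simp_all
  then have lower: "frob C X\<^sub>S - \<epsilon> \<le> frob C X\<^sub>\<epsilon>"
    using near unfolding lse_objective_def by linarith
  have "?R * (\<beta> - l1norm y\<^sub>S) \<le> \<beta> * ?L + \<epsilon>"
    using near upper[OF psd\<epsilon>] by (simp add: mult.commute)
  then have viol: "?R \<le> ?D"
    using gap by (simp add: pos_le_divide_eq)
  have "frob C X\<^sub>\<epsilon> \<le> frob C X\<^sub>S + l1norm y\<^sub>S * ?R"
    using frob_le_dual_plus_violation[OF lin y psd\<epsilon>, of b] dual by simp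
  also have "\<dots> \<le> frob C X\<^sub>S + l1norm y\<^sub>S * ?D"
    using viol by (intro add_left_mono mult_left_mono) (simp_all add: l1norm_def sum_nonneg)
  finally show ?thesis using lower viol by blast
qed

end
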